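(* Let $a(t)=\sum_{n\ge0}a_nt^n$ and $b(t)=\sum_{n\ge0}b_nt^n$ be formal power series in $\mathbb{C}[[t]]$. If $a(t)$ and $b(t)$ are rational, then the LR-derived generating function $a(t)\ast_{LR}b(t)$ is also rational.
   Context: For $a(t)=\sum_{n\ge0}a_nt^n$ and $b(t)=\sum_{n\ge0}b_nt^n$ in $\mathbb{C}[[t]]$, the Littlewood-Richardson derived (LR-derived) generating function is $a(t)\ast_{LR}b(t)=\sum_{n\ge0}\left(\sum_{k=0}^n\binom{n}{k}a_kb_{n-k}\right)t^n\in\mathbb{C}[[t]]$. Equivalently, it is the ordinary generating function $\sum_n c_nt^n$ of the sequence $\{c_n\}$ determined by $\sum_n c_n\frac{t^n}{n!}=\left(\sum_n a_n\frac{t^n}{n!}\right)\left(\sum_n b_n\frac{t^n}{n!}\right)$. A formal power series in $\mathbb{C}[[t]]$ is rational if it is the power series expansion at $0$ of an element of $\mathbb{C}(t)$. *)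

theory Defs
  imports
    Complex_Main
    "HOL-Computational_Algebra.Computational_Algebra"
    "HOL-Computational_Algebra.Field_as_Ring"
begin

unbundle fps_syntax

text \<open>
  The field of rational functions is the type \<open>complex poly fract\<close>. Expansion at 0 is its
  embedding into the Laurent series, as a rational function may have a pole at 0. The pair
  \<open>quot_of_fract r\<close> is the reduced numerator and denominator, but any representation gives
  the same series, by \<open>fls_of_ratfun_Fract\<close>.
\<close>

definition fls_of_ratfun :: "complex poly fract \<Rightarrow> complex fls" where
  "fls_of_ratfun r =
     (case quot_of_fract r of (p, q) \<Rightarrow> fps_to_fls (fps_of_poly p) / fps_to_fls (fps_of_poly q))"

lemma fls_of_ratfun_Fract:
  assumes "q \<noteq> 0"
  shows "fls_of_ratfun (Fract p q) = fps_to_fls (fps_of_poly p) / fps_to_fls (fps_of_poly q)"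
proof -
  obtain p' q' where pq': "quot_of_fract (Fract p q) = (p', q')"
    by (cases "quot_of_fract (Fract p q)")
  have nz: "q' \<noteq> 0"
    using snd_quot_of_fract_nonzero[of "Fract p q"] by (simp add: pq')
  have "Fract p' q' = Fract p q"
    using Fract_quot_of_fract[of "Fract p q"] by (simp add: pq')
  with assms nz have eq: "p' * q = p * q'"
    by (simp add: eq_fract)
  have "fps_to_fls (fps_of_poly p') * fps_to_fls (fps_of_poly q) =
        fps_to_fls (fps_of_poly p) * fps_to_fls (fps_of_poly q')"
    by (simp only: fls_times_fps_to_fls[symmetric] fps_of_poly_mult[symmetric] eq)
  with assms nz show ?thesis
    by (simp add: fls_of_ratfun_def pq' frac_eq_eq)
qed

definition rational_fps :: "complex fps \<Rightarrow> bool" where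
  "rational_fps f \<longleftrightarrow> (\<exists>r. fps_to_fls f = fls_of_ratfun r)"

definition LR_derived :: "complex fps \<Rightarrow> complex fps \<Rightarrow> complex fps"
    (infixl \<open>\<star>\<^sub>L\<^sub>R\<close> 70) where
  "a \<star>\<^sub>L\<^sub>R b = Abs_fps (\<lambda>n. \<Sum>k=0..n. of_nat (n choose k) * a $ k * b $ (n - k))"

lemma LR_derived_egf:
  "Abs_fps (\<lambda>n. (a \<star>\<^sub>L\<^sub>R b) $ n / fact n) =
   Abs_fps (\<lambda>n. a $ n / fact n) * Abs_fps (\<lambda>n. b $ n / fact n)"
  by (simp add: fps_eq_iff LR_derived_def fps_mult_nth sum_divide_distrib binomial_fact
           field_simps)

end

theory Submission
  imports Defs
begin

text \<open>
  A power series is rational iff it lies in a finite-dimensional space of power series that is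
  closed under the shift, which drops the constant coefficient and divides by \<open>X\<close>. On exponential
  generating functions the shift is differentiation, so it is a derivation of the LR-product.
  Hence if \<open>U\<close> and \<open>V\<close> are finite-dimensional and shift-closed, then so is the span of the
  products of their elements.
\<close>

text \<open>Clearing the denominator removes the Laurent series, so that only polynomials and power
  series occur from here on. The equation makes sense even when \<open>q\<close> vanishes at
  0.\<close>

lemma rational_fps_iff:
  "rational_fps f \<longleftrightarrow> (\<exists>p q. q \<noteq> 0 \<and> fps_of_poly q * f = fps_of_poly p)"
proof
  assume "rational_fps f"
  then obtain r where r: "fps_to_fls f = fls_of_ratfun r"
    by (auto simp: rational_fps_def)
  obtain p q where "r = Fract p q" "q \<noteq> 0"
    by (cases r) auto
  with r have "fps_to_fls (fps_of_poly q * f) = fps_to_fls (fps_of_poly p)"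
    by (simp add: fls_of_ratfun_Fract fls_times_fps_to_fls)
  then show "\<exists>p q. q \<noteq> 0 \<and> fps_of_poly q * f = fps_of_poly p"
    using \<open>q \<noteq> 0\<close> by auto
next
  assume "\<exists>p q. q \<noteq> 0 \<and> fps_of_poly q * f = fps_of_poly p"
  then obtain p q where pq: "q \<noteq> 0" "fps_of_poly q * f = fps_of_poly p"
    by blast
  then have "fps_to_fls f = fls_of_ratfun (Fract p q)"
    by (simp add: fls_of_ratfun_Fract fls_times_fps_to_fls flip: pq(2))
  then show "rational_fps f"
    unfolding rational_fps_def by blast
qed

text \<open>The power of \<open>X\<close> dividing the denominator can be cancelled, because
  \<open>f\<close> has no pole at 0. What remains is a denominator that is invertible as a power
  series.\<close>

lemma rational_fps_denom_nonzero:
  assumes "rational_fps f"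
  obtains p q where "coeff q 0 \<noteq> 0" "fps_of_poly q * f = fps_of_poly p"
proof -
  obtain p q where pq: "q \<noteq> 0" "fps_of_poly q * f = fps_of_poly p"
    using assms by (auto simp: rational_fps_iff)
  obtain q' where q': "q = [:0, 1:] ^ order 0 q * q'" "\<not> [:0, 1:] dvd q'"
    using order_decomp[OF pq(1), of 0] by auto
  let ?m = "order 0 q"
  have "fps_of_poly q = fps_X ^ ?m * fps_of_poly q'"
    by (subst q'(1)) (simp add: fps_of_poly_mult fps_of_poly_power fps_of_poly_pCons)
  then have "fps_of_poly q * f = (fps_of_poly q' * f) * fps_X ^ ?m"
    by (simp add: ac_simps)
  \<comment> \<open>Shifting undoes the multiplication by the power of \<open>X\<close>, which
    avoids proving separately that this power divides \<open>p\<close>.\<close>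
  then have "fps_of_poly q' * f = fps_shift ?m (fps_of_poly p)"
    by (metis fps_shift_times_fps_X_power' pq(2))
  moreover have "coeff q' 0 \<noteq> 0"
    using q'(2) poly_eq_0_iff_dvd[of q' 0] by (simp add: poly_0_coeff_0)
  ultimately show thesis
    using that[of q' "poly_shift ?m p"] by (simp add: fps_of_poly_shift)
qed

global_interpretation fps_vs: vector_space "\<lambda>c::complex. (*) (fps_const c)"
  by unfold_locales (simp_all add: algebra_simps flip: fps_const_add fps_const_mult)

text \<open>\<open>T\<close> is a finite set of generators of a shift-closed space. The condition is
  imposed on generators only; linearity of the shift carries it over to the span.\<close>

abbreviation shift_finite :: "complex fps set \<Rightarrow> bool" where
  "shift_finite T \<equiv> finite T \<and> fps_shift 1 ` T \<subseteq> fps_vs.span T"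

lemma linear_fps_shift:
  "Vector_Spaces.linear (\<lambda>c::complex. (*) (fps_const c)) (\<lambda>c. (*) (fps_const c)) (fps_shift n)"
  by unfold_locales (simp_all add: fps_eq_iff)

lemma fps_shift_in_span:
  assumes "fps_shift 1 ` T \<subseteq> fps_vs.span T" "f \<in> fps_vs.span T"
  shows "fps_shift k f \<in> fps_vs.span T"
proof (induction k)
  case (Suc k)
  interpret shift: Vector_Spaces.linear "\<lambda>c::complex. (*) (fps_const c)"
    "\<lambda>c. (*) (fps_const c)" "fps_shift 1"
    by (rule linear_fps_shift)
  have "fps_shift (Suc k) f = fps_shift 1 (fps_shift k f)"
    by (simp add: fps_eq_iff)
  also have "\<dots> \<in> fps_vs.span (fps_shift 1 ` T)"
    unfolding shift.span_image using Suc by (rule imageI)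
  also have "\<dots> \<subseteq> fps_vs.span T"
    using assms(1) by (simp add: fps_vs.span_minimal)
  finally show ?case .
qed (simp add: assms)

text \<open>The \<open>card T + 1\<close> members lie in a space of dimension at most
  \<open>card T\<close>. The relation is indexed by numbers, not by a set of vectors, so repeated
  members have to be treated separately: two equal ones already give a relation.\<close>

lemma fps_family_dependent:
  fixes g :: "nat \<Rightarrow> complex fps"
  assumes "finite T" "\<And>k. g k \<in> fps_vs.span T"
  obtains c k0 where "k0 \<le> card T" "c k0 \<noteq> 0" "(\<Sum>k\<le>card T. fps_const (c k) * g k) = 0"
proof (cases "inj_on g {..card T}")
  case False
  then obtain i j where ij: "i \<le> card T" "j \<le> card T" "i \<noteq> j" "g i = g j"
    by (auto simp: inj_on_def)
  define c :: "nat \<Rightarrow> complex" where "c k = (if k = i then 1 else 0) - (if k = j then 1 else 0)" for k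
  have "(\<Sum>k\<le>card T. fps_const (c k) * g k) =
      (\<Sum>k\<le>card T. if k = i then g k else 0) - (\<Sum>k\<le>card T. if k = j then g k else 0)"
    unfolding sum_subtractf[symmetric] by (rule sum.cong) (auto simp: c_def ij)
  then show thesis
    using that[of i c] ij by (simp add: c_def)
next
  case True
  have "fps_vs.dependent (g ` {..card T})"
  proof (rule ccontr)
    assume "fps_vs.independent (g ` {..card T})"
    then have "card (g ` {..card T}) \<le> card T"
      using fps_vs.independent_span_bound[OF assms(1)] assms(2) by blast
    then show False
      using True by (simp add: card_image)
  qed
  then obtain u v where "v \<in> g ` {..card T}" "u v \<noteq> 0"
      "(\<Sum>v\<in>g ` {..card T}. fps_const (u v) * v) = 0"
    by (auto simp: fps_vs.dependent_finite)
  then show thesis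
    using that[of _ "u \<circ> g"] True by (auto simp: sum.reindex)
qed

text \<open>A linear relation between the shifts of \<open>f\<close> is a linear recurrence with
  constant coefficients for its coefficients.\<close>

lemma shift_finite_imp_rational:
  assumes "shift_finite T" "f \<in> fps_vs.span T"
  shows "rational_fps f"
proof -
  have "finite T" "\<And>k. fps_shift k f \<in> fps_vs.span T"
    using assms fps_shift_in_span by blast+
  then obtain c k0 where k0: "k0 \<le> card T" "c k0 \<noteq> 0"
    and sum0: "(\<Sum>k\<le>card T. fps_const (c k) * fps_shift k f) = 0"
    by (rule fps_family_dependent)
  define N where "N = card T"
  \<comment> \<open>The reversed characteristic polynomial of the recurrence. Multiplying the
    relation by \<open>X^N\<close> and replacing \<open>X^k * fps_shift k f\<close> by
    \<open>f\<close> minus its first \<open>k\<close> terms yields \<open>q * f = p\<close>, where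
    \<open>p\<close> collects those initial terms.\<close>
  define q where "q = (\<Sum>k\<le>N. monom (c k) (N - k))"
  define p where "p = (\<Sum>k\<le>N. monom (c k) (N - k) * truncate_fps k f)"
  \<comment> \<open>For \<open>k\<close> up to \<open>N\<close> the exponents \<open>N - k\<close>
    are distinct, so the nonzero \<open>c k0\<close> cannot cancel.\<close>
  have "coeff q (N - k0) = (\<Sum>k\<le>N. if k = k0 then c k else 0)"
    unfolding q_def coeff_sum using k0 by (intro sum.cong) (auto simp: N_def)
  then have "q \<noteq> 0"
    using k0 by (auto simp: N_def)
  moreover have "fps_of_poly q * f = fps_of_poly p"
  proof -
    have term_eq: "fps_of_poly (monom (c k) (N - k)) * f =
        fps_X ^ N * (fps_const (c k) * fps_shift k f) +
        fps_of_poly (monom (c k) (N - k) * truncate_fps k f)" if "k \<le> N" for k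
    proof -
      have f: "f = fps_X ^ k * fps_shift k f + fps_cutoff k f"
        by (simp only: fps_shift_cutoff')
      have "fps_X ^ N = fps_X ^ (N - k) * (fps_X ^ k :: complex fps)"
        using that by (simp flip: power_add)
      then have "fps_X ^ N * (fps_const (c k) * fps_shift k f) +
          fps_of_poly (monom (c k) (N - k) * truncate_fps k f) =
        fps_of_poly (monom (c k) (N - k)) * (fps_X ^ k * fps_shift k f + fps_cutoff k f)"
        by (simp add: fps_of_poly_mult fps_of_poly_monom algebra_simps)
      then show ?thesis
        by (simp only: f[symmetric])
    qed
    have "fps_of_poly q * f = fps_X ^ N * (\<Sum>k\<le>N. fps_const (c k) * fps_shift k f) + fps_of_poly p"
      by (simp add: q_def p_def fps_of_poly_sum sum_distrib_right sum_distrib_left term_eq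
          flip: sum.distrib)
    then show ?thesis
      using sum0 by (simp add: N_def)
  qed
  ultimately show ?thesis
    by (auto simp: rational_fps_iff)
qed

lemma fps_of_poly_mult_in_span:
  assumes "degree p \<le> N"
  shows "fps_of_poly p * h \<in> fps_vs.span ((\<lambda>i. fps_X ^ i * h) ` {..N})"
proof -
  have "fps_of_poly p * h = (\<Sum>i\<le>N. fps_const (coeff p i) * (fps_X ^ i * h))"
    by (subst poly_as_sum_of_monoms'[OF assms, symmetric])
       (simp add: fps_of_poly_sum fps_of_poly_monom sum_distrib_right mult.assoc)
  also have "\<dots> \<in> fps_vs.span ((\<lambda>i. fps_X ^ i * h) ` {..N})"
    by (intro fps_vs.span_sum fps_vs.span_scale fps_vs.span_base) auto
  finally show ?thesis .
qed

text \<open>The space consists of the fractions with denominator \<open>q\<close> and numerator of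
  degree at most \<open>N\<close>. The shift lowers the exponent of a generator
  \<open>X^i * h\<close> when \<open>i\<close> is positive; only \<open>h\<close> itself needs an
  argument.\<close>

lemma rational_imp_shift_finite:
  assumes "rational_fps f"
  obtains T where "shift_finite T" "f \<in> fps_vs.span T"
proof -
  obtain p q where q0: "coeff q 0 \<noteq> 0" and pq: "fps_of_poly q * f = fps_of_poly p"
    using rational_fps_denom_nonzero[OF assms] .
  define h where "h = inverse (fps_of_poly q)"
  \<comment> \<open>The degree of \<open>p\<close> is needed for \<open>f = p * h\<close>, that of
    \<open>q\<close> for the shift of \<open>h\<close>.\<close>
  define N where "N = max (degree p) (degree q)"
  define T where "T = (\<lambda>i. fps_X ^ i * h) ` {..N}"
  have qh: "h * fps_of_poly q = 1"
    using q0 by (simp add: h_def inverse_mult_eq_1)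
  have "fps_shift 1 (fps_X ^ i * h) \<in> fps_vs.span T" if "i \<le> N" for i
  proof (cases i)
    case 0
    obtain c q' where q: "q = pCons c q'"
      by (cases q)
    \<comment> \<open>Multiply \<open>(c + X * q') * h = 1\<close> by \<open>h $ 0\<close>, which is
      the inverse of \<open>c\<close>, and solve for the summand \<open>h\<close>.\<close>
    have "h = fps_const (h $ 0) + fps_of_poly (smult (- (h $ 0)) q') * h * fps_X"
    proof -
      have c: "c * (h $ 0) = 1"
        using q0 by (simp add: h_def q)
      have "h = h * fps_const (c * (h $ 0))"
        by (simp add: c)
      also have "\<dots> = fps_const (h $ 0) * (h * fps_of_poly q) - fps_const (h $ 0) * fps_of_poly q' * h * fps_X"
        by (simp add: q fps_of_poly_pCons algebra_simps flip: fps_const_mult)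
      finally show ?thesis
        by (simp add: qh fps_of_poly_smult fps_of_poly_uminus algebra_simps)
    qed
    then have "fps_shift 1 h =
        fps_shift 1 (fps_const (h $ 0) + fps_of_poly (smult (- (h $ 0)) q') * h * fps_X)"
      by (rule arg_cong)
    then have "fps_shift 1 h = fps_of_poly (smult (- (h $ 0)) q') * h"
      by (simp only: fps_shift_add fps_shift_times_fps_X' fps_shift_fps_const) simp
    moreover have "degree (smult (- (h $ 0)) q') \<le> N"
      by (rule order.trans[OF degree_smult_le]) (auto simp: N_def q degree_pCons_eq_if split: if_splits)
    ultimately show ?thesis
      using 0 by (simp add: T_def fps_of_poly_mult_in_span)
  next
    case (Suc j)
    have "fps_shift 1 (fps_X ^ i * h) = fps_X ^ j * h"
      using fps_shift_times_fps_X'[of "fps_X ^ j * h"] by (simp add: Suc ac_simps)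
    then show ?thesis
      using that Suc by (auto simp: T_def intro!: fps_vs.span_base)
  qed
  moreover have "f \<in> fps_vs.span T"
  proof -
    have "f = fps_of_poly p * h"
      using qh by (metis mult.assoc mult.commute mult_1 pq)
    then show ?thesis
      by (simp add: T_def N_def fps_of_poly_mult_in_span)
  qed
  ultimately show thesis
    using that[of T] by (auto simp: T_def)
qed

text \<open>This is the Leibniz rule for exponential generating functions, pulled back along the
  injective map \<open>egf\<close>.\<close>

lemma fps_shift_LR_derived:
  "fps_shift 1 (a \<star>\<^sub>L\<^sub>R b) = fps_shift 1 a \<star>\<^sub>L\<^sub>R b + a \<star>\<^sub>L\<^sub>R fps_shift 1 b"
proof -
  define egf :: "complex fps \<Rightarrow> complex fps" where "egf f = Abs_fps (\<lambda>n. f $ n / fact n)" for f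
  have inj: "f = g" if "egf f = egf g" for f g
    using that by (simp add: egf_def fps_eq_iff)
  have deriv: "egf (fps_shift 1 f) = fps_deriv (egf f)" for f
    by (simp add: egf_def fps_eq_iff field_simps del: of_nat_Suc)
  have mult: "egf (f \<star>\<^sub>L\<^sub>R g) = egf f * egf g" for f g
    by (simp add: egf_def LR_derived_egf)
  have add: "egf (f + g) = egf f + egf g" for f g
    by (simp add: egf_def fps_eq_iff add_divide_distrib)
  show ?thesis
    by (rule inj) (simp only: deriv mult add fps_deriv_mult, simp only: ac_simps)
qed

lemma LR_derived_in_span:
  assumes "x \<in> fps_vs.span S" "y \<in> fps_vs.span T"
  shows "x \<star>\<^sub>L\<^sub>R y \<in> fps_vs.span ((\<lambda>(g, h). g \<star>\<^sub>L\<^sub>R h) ` (S \<times> T))"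
    (is "_ \<in> fps_vs.span ?P")
proof -
  interpret left: Vector_Spaces.linear "\<lambda>c::complex. (*) (fps_const c)"
    "\<lambda>c. (*) (fps_const c)" "\<lambda>g. g \<star>\<^sub>L\<^sub>R h" for h
    by unfold_locales
       (simp_all add: fps_eq_iff LR_derived_def algebra_simps sum.distrib sum_distrib_left)
  interpret right: Vector_Spaces.linear "\<lambda>c::complex. (*) (fps_const c)"
    "\<lambda>c. (*) (fps_const c)" "\<lambda>h. g \<star>\<^sub>L\<^sub>R h" for g
    by unfold_locales
       (simp_all add: fps_eq_iff LR_derived_def algebra_simps sum.distrib sum_distrib_left)
  \<comment> \<open>Bilinearity is used one factor at a time: first \<open>y\<close> is expanded for
    a fixed generator \<open>g\<close>, then \<open>x\<close> for the fixed
    \<open>y\<close>.\<close>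
  have "(\<lambda>y. g \<star>\<^sub>L\<^sub>R y) ` T \<subseteq> ?P" if "g \<in> S" for g
    using that by auto
  then have "fps_vs.span ((\<lambda>y. g \<star>\<^sub>L\<^sub>R y) ` T) \<subseteq> fps_vs.span ?P" if "g \<in> S" for g
    using that by (intro fps_vs.span_mono)
  moreover have "g \<star>\<^sub>L\<^sub>R y \<in> fps_vs.span ((\<lambda>y. g \<star>\<^sub>L\<^sub>R y) ` T)" for g
    unfolding right.span_image using assms(2) by (rule imageI)
  ultimately have "fps_vs.span ((\<lambda>g. g \<star>\<^sub>L\<^sub>R y) ` S) \<subseteq> fps_vs.span ?P"
    by (intro fps_vs.span_minimal fps_vs.subspace_span) auto
  moreover have "x \<star>\<^sub>L\<^sub>R y \<in> fps_vs.span ((\<lambda>g. g \<star>\<^sub>L\<^sub>R y) ` S)"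
    unfolding left.span_image using assms(1) by (rule imageI)
  ultimately show ?thesis
    by (rule subsetD)
qed

theorem proposition3:
  fixes a b :: "complex fps"
  assumes "rational_fps a" and "rational_fps b"
  shows "rational_fps (a \<star>\<^sub>L\<^sub>R b)"
proof -
  obtain S where S: "shift_finite S" "a \<in> fps_vs.span S"
    using rational_imp_shift_finite[OF assms(1)] .
  obtain T where T: "shift_finite T" "b \<in> fps_vs.span T"
    using rational_imp_shift_finite[OF assms(2)] .
  let ?P = "(\<lambda>(g, h). g \<star>\<^sub>L\<^sub>R h) ` (S \<times> T)"
  \<comment> \<open>In each summand of the Leibniz rule one factor is still a generator, and the
    other is a shifted generator, hence in its span.\<close>
  have "fps_shift 1 (g \<star>\<^sub>L\<^sub>R h) \<in> fps_vs.span ?P" if "g \<in> S" "h \<in> T" for g h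
    unfolding fps_shift_LR_derived using that S(1) T(1)
    by (intro fps_vs.span_add LR_derived_in_span) (auto intro: fps_vs.span_base)
  then have "shift_finite ?P"
    using S(1) T(1) by auto
  then show ?thesis
    using LR_derived_in_span[OF S(2) T(2)] by (rule shift_finite_imp_rational)
qed

end
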